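(* For all integers $a_1,b_1,a_2,b_2,T$ with $0<a_1\le b_1$, $0<a_2\le b_2$ and $T\ge b_1+b_2$ (and whatever the per-channel delays $T_1,T_2<T$ of the two hops, with $b_1\le T_1$ and $b_2\le T_2$), the capacity of the three-node decode-and-forward relay network satisfies $$\mathsf{C}_{a_1,b_1,a_2,b_2,T}\;\le\;\min\{\mathsf{C}_{a_1,b_1,T-b_2},\ \mathsf{C}_{a_2,b_2,T-b_1}\},$$ where $\mathsf{C}_{a,b,\tau}=\dfrac{\tau-a+1}{\tau-a+1+b}$ denotes the point-to-point channel capacity.
   Context: **DCSW channel.** For integers $0<a\le b\le \tau$, an $(a,b,\tau)$ delay-constrained sliding-window (DCSW) channel is a packet-erasure channel over time slots $0,1,2,\dots$ with decoding delay $\tau$ and window size $w=\tau+1$. A set $E\subseteq\mathbb{Z}_{\ge 0}$ of erased time slots is a permissible erasure pattern if, for every window $W$ of $w$ consecutive time slots, $E\cap W$ either has at most $a$ elements, or is a single burst, i.e. a set of consecutive time slots, of length at most $b$. The point-to-point channel capacity is $\mathsf{C}_{a,b,\tau}=\frac{\tau-a+1}{\tau-a+1+b}$. **Three-node decode-and-forward (D&F) relay network.** There is a source $s$, a relay $r$ and a destination $d$. The channel $(s,r)$ is an $(a_1,b_1,T_1)$ DCSW channel and the channel $(r,d)$ is an $(a_2,b_2,T_2)$ DCSW channel, where $T_1,T_2<T$ (the network is considered for given $T_1,T_2$, which are not displayed in the notation below). A packet-level code with parameters $(k,n_1,n_2)_{\mathbb{F}_q}$ (with $q$ a prime power, $k\ge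 1$) works as follows. - At each time $i\ge 0$ the source has a message packet $\boldsymbol{m}_i\in\mathbb{F}_q^k$ (the message packets are arbitrary) and transmits $\boldsymbol{x}_i=[\boldsymbol{m}_i^{\top},\boldsymbol{p}_i^{\top}]^{\top}\in\mathbb{F}_q^{n_1}$, where the parity $\boldsymbol{p}_i\in\mathbb{F}_q^{n_1-k}$ is a function of $\boldsymbol{m}_0,\dots,\boldsymbol{m}_i$. The relay receives $\boldsymbol{y}^{(r)}_i$, equal to $\boldsymbol{x}_i$ if slot $i$ is not erased on $(s,r)$ and to the erasure symbol $*$ otherwise. - At the same time $i$ the relay transmits $\boldsymbol{x}^{(r)}_i\in\mathbb{F}_q^{n_2}$, computed from $\boldsymbol{y}^{(r)}_0,\dots,\boldsymbol{y}^{(r)}_i$. The relay encoding does not take into account the erasure pattern observed on $(s,r)$: for each $i$ there is a fixed function $g_i$ such that $\boldsymbol{x}^{(r)}_i=g_i(\boldsymbol{m}_0,\dots,\boldsymbol{m}_i)$ for every permissible erasure pattern of $(s,r)$. (So, for every permissible pattern, this value must be determined by $\boldsymbol{y}^{(r)}_0,\dots,\boldsymbol{y}^{(r)}_i$.) - The destination receives $\boldsymbol{y}_i$, equal to $\boldsymbol{x}^{(r)}_i$ if slot $i$ is not erased on $(r,d)$ and to $*$ otherwise. The code is an $(a_1,b_1,a_2,b_2,T)$ streaming code if, for every permissible erasure pattern of $(s,r)$ and every permissible erasure pattern of $(r,d)$, the destination can recover $\boldsymbol{m}_i$ from $\boldsymbol{y}_0,\dots,\boldsymbol{y}_{i+T}$,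 for every $i\ge 0$. Its rate is $\mathsf{R}_{(s,r,d)}=\frac{k}{\max\{n_1,n_2\}}$. **Capacity.** $\mathsf{C}_{a_1,b_1,a_2,b_2,T}$ is the supremum of $\frac{k}{\max\{n_1,n_2\}}$ over all $q,k,n_1,n_2$ for which there exists an $(a_1,b_1,a_2,b_2,T)$ streaming code with parameters $(k,n_1,n_2)_{\mathbb{F}_q}$. *)

theory Defs
  imports Complex_Main "HOL-Algebra.Ring"
begin

text \<open>
  Erasure patterns of an \<open>(a, b, \<tau>)\<close> delay-constrained sliding-window channel; the windows
  \<open>{s..s + \<tau>}\<close> have \<open>\<tau> + 1\<close> slots.
\<close>

definition permissible :: "nat \<Rightarrow> nat \<Rightarrow> nat \<Rightarrow> nat set \<Rightarrow> bool" where
  "permissible a b \<tau> E \<longleftrightarrow>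
     (\<forall>s. card (E \<inter> {s..s + \<tau>}) \<le> a \<or> (\<exists>c l. l \<le> b \<and> E \<inter> {s..s + \<tau>} = {c..<c + l}))"

definition p2p_capacity :: "nat \<Rightarrow> nat \<Rightarrow> nat \<Rightarrow> real" where
  "p2p_capacity a b \<tau> = (real \<tau> - real a + 1) / (real \<tau> - real a + 1 + real b)"

definition packets :: "('a, 'b) ring_scheme \<Rightarrow> nat \<Rightarrow> 'a list set" where
  "packets F n = {v. set v \<subseteq> carrier F \<and> length v = n}"

definition upto_time :: "(nat \<Rightarrow> 'p) \<Rightarrow> nat \<Rightarrow> 'p list" where
  "upto_time z i = map z [0..<Suc i]"

text \<open>The erasure symbol is \<open>None\<close>.\<close>

definition received :: "nat set \<Rightarrow> (nat \<Rightarrow> 'p) \<Rightarrow> nat \<Rightarrow> 'p option" where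
  "received E x i = (if i \<in> E then None else Some (x i))"

definition source_tx ::
  "(nat \<Rightarrow> 'a list list \<Rightarrow> 'a list) \<Rightarrow> (nat \<Rightarrow> 'a list) \<Rightarrow> nat \<Rightarrow> 'a list" where
  "source_tx par m i = m i @ par i (upto_time m i)"

definition relay_tx ::
  "(nat \<Rightarrow> 'a list list \<Rightarrow> 'a list) \<Rightarrow> (nat \<Rightarrow> 'a list option list \<Rightarrow> 'a list) \<Rightarrow>
   nat set \<Rightarrow> (nat \<Rightarrow> 'a list) \<Rightarrow> nat \<Rightarrow> 'a list" where
  "relay_tx par rel E m i = rel i (upto_time (received E (source_tx par m)) i)"

text \<open>
  A packet-level decode-and-forward code with parameters \<open>(k, n1, n2)\<close> over the field \<open>F\<close>, where the
  source-relay channel is an \<open>(a1, b1, T1)\<close> channel. The encoders are arbitrary, not necessarily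
  linear, functions. The relay sees only its received packets, whereas \<open>g\<close> depends on the messages
  but not on the erasure pattern.
\<close>

definition df_code ::
  "('a, 'b) ring_scheme \<Rightarrow> nat \<Rightarrow> nat \<Rightarrow> nat \<Rightarrow> nat \<Rightarrow> nat \<Rightarrow> nat \<Rightarrow>
   (nat \<Rightarrow> 'a list list \<Rightarrow> 'a list) \<Rightarrow> (nat \<Rightarrow> 'a list option list \<Rightarrow> 'a list) \<Rightarrow> bool" where
  "df_code F a1 b1 T1 k n1 n2 par rel \<longleftrightarrow>
     1 \<le> k \<and> k \<le> n1 \<and>
     (\<forall>m i. (\<forall>j. m j \<in> packets F k) \<longrightarrow> par i (upto_time m i) \<in> packets F (n1 - k)) \<and>
     (\<forall>E m i. permissible a1 b1 T1 E \<longrightarrow> (\<forall>j. m j \<in> packets F k) \<longrightarrow>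
        relay_tx par rel E m i \<in> packets F n2) \<and>
     (\<exists>g. \<forall>E m i. permissible a1 b1 T1 E \<longrightarrow> (\<forall>j. m j \<in> packets F k) \<longrightarrow>
        relay_tx par rel E m i = g i (upto_time m i))"

text \<open>
  The decoder \<open>dec i\<close> is given the packets of slots \<open>0, \<dots>, i + T\<close> only; it is the same for all
  erasure patterns, since the erasures on the relay-destination channel are visible in its input
  and the relay's packets do not depend on those of the source-relay channel.
\<close>

definition streaming_code ::
  "('a, 'b) ring_scheme \<Rightarrow> nat \<Rightarrow> nat \<Rightarrow> nat \<Rightarrow> nat \<Rightarrow> nat \<Rightarrow> nat \<Rightarrow> nat \<Rightarrow>
   nat \<Rightarrow> nat \<Rightarrow> nat \<Rightarrow>
   (nat \<Rightarrow> 'a list list \<Rightarrow> 'a list) \<Rightarrow> (nat \<Rightarrow> 'a list option list \<Rightarrow> 'a list) \<Rightarrow> bool" where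
  "streaming_code F a1 b1 T1 a2 b2 T2 T k n1 n2 par rel \<longleftrightarrow>
     df_code F a1 b1 T1 k n1 n2 par rel \<and>
     (\<exists>dec. \<forall>E1 E2 m i. permissible a1 b1 T1 E1 \<longrightarrow> permissible a2 b2 T2 E2 \<longrightarrow>
        (\<forall>j. m j \<in> packets F k) \<longrightarrow>
        dec i (upto_time (received E2 (relay_tx par rel E1 m)) (i + T)) = m i)"

text \<open>
  Every finite field is isomorphic to one whose carrier consists of natural numbers, so ranging over
  \<open>F :: nat ring\<close> covers all prime powers \<open>q\<close>.
\<close>

definition achievable_rates ::
  "nat \<Rightarrow> nat \<Rightarrow> nat \<Rightarrow> nat \<Rightarrow> nat \<Rightarrow> nat \<Rightarrow> nat \<Rightarrow> real set" where
  "achievable_rates a1 b1 T1 a2 b2 T2 T =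
     {real k / real (max n1 n2) | k n1 n2.
        \<exists>(F :: nat ring) par rel. field F \<and> finite (carrier F) \<and>
          streaming_code F a1 b1 T1 a2 b2 T2 T k n1 n2 par rel}"

definition df_capacity ::
  "nat \<Rightarrow> nat \<Rightarrow> nat \<Rightarrow> nat \<Rightarrow> nat \<Rightarrow> nat \<Rightarrow> nat \<Rightarrow> real" where
  "df_capacity a1 b1 T1 a2 b2 T2 T = Sup (achievable_rates a1 b1 T1 a2 b2 T2 T)"

end

theory Submission
  imports Defs "HOL-Library.FuncSet"
begin

text \<open>
  A burst of length \<open>b2\<close> in the last slots before the deadline of \<open>m i\<close> forces the relay to know
  \<open>m i\<close> by time \<open>i + T - b2\<close>. A burst of length \<open>b1\<close> on the first hop, together with the independence
  of the relay's packets from the erasure pattern, forces the packet of slot \<open>i + b1\<close> to depend only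
  on \<open>m 0, \<dots>, m i\<close>. So each hop, after a shift of time for the second one, is a causal code of
  delay \<open>T - b2\<close> respectively \<open>T - b1\<close>. For such a code with delay \<open>\<tau>\<close> one erases \<open>b\<close> slots in every
  period of \<open>\<tau> - a + 1 + b\<close> slots and decodes message by message: since all earlier messages are
  already known, only the erasures in \<open>{i..i + \<tau>}\<close> matter for \<open>m i\<close>, and these are at most \<open>a\<close> or lie in
  a burst of length at most \<open>b\<close>. Such finite patterns are permissible for every window size, which
  is why \<open>T1\<close> and \<open>T2\<close> do not enter the bound. Counting message sequences finishes the proof. The
  supremum is over a nonempty set because of a repetition code.
\<close>

section \<open>Erasure patterns\<close>

lemma permissible_burst:
  assumes "l \<le> b"
  shows "permissible a b \<tau> {c..<c + l}"
  unfolding permissible_def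
proof (intro allI disjI2)
  fix s
  define u where "u = max c s"
  define v where "v = min (c + l) (Suc (s + \<tau>))"
  have "{c..<c + l} \<inter> {s..s + \<tau>} = {u..<u + (v - u)}"
    unfolding u_def v_def by auto
  moreover have "v - u \<le> b"
    using assms unfolding u_def v_def by linarith
  ultimately show "\<exists>c' l'. l' \<le> b \<and> {c..<c + l} \<inter> {s..s + \<tau>} = {c'..<c' + l'}"
    by blast
qed

lemma permissible_card:
  assumes "finite E" "card E \<le> a"
  shows "permissible a b \<tau> E"
  unfolding permissible_def
  by (metis assms card_mono inf_le1 le_trans)

text \<open>Since \<open>b \<le> \<tau>\<close>, any \<open>b + 1\<close> consecutive slots fit into
  one window, and a permissible pattern erases at most \<open>b\<close> slots of it because
  \<open>a \<le> b\<close>.\<close>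

lemma permissible_unerased:
  assumes E: "permissible a b \<tau> E" and "a \<le> b" "b \<le> \<tau>"
  shows "\<exists>e\<le>b. s + e \<notin> E"
proof (rule ccontr)
  assume neg: "\<not> ?thesis"
  have "{s..s + b} \<subseteq> E \<inter> {s..s + \<tau>}"
  proof
    fix x assume x: "x \<in> {s..s + b}"
    then have "x - s \<le> b" "s + (x - s) = x" by auto
    with neg have "x \<in> E" by metis
    then show "x \<in> E \<inter> {s..s + \<tau>}" using x \<open>b \<le> \<tau>\<close> by auto
  qed
  then have "card {s..s + b} \<le> card (E \<inter> {s..s + \<tau>})"
    by (intro card_mono) auto
  moreover have "card (E \<inter> {s..s + \<tau>}) \<le> b"
    using E \<open>a \<le> b\<close> unfolding permissible_def
    by (metis (no_types, lifting) add_diff_cancel_left' card_atLeastLessThan le_trans)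
  ultimately show False by simp
qed

text \<open>As \<open>\<tau> + 1 \<le> P\<close>, a window meets at most two of the periodic bursts.
  If it meets both, it contains the whole gap of \<open>\<tau> + 1 - a\<close> slots between them,
  so at most \<open>a\<close> erased slots remain. A superset \<open>E\<close> is enough, since
  decoding that tolerates \<open>E\<close> also tolerates fewer erasures.\<close>

lemma periodic_window:
  fixes a b \<tau> i :: nat
  assumes "a \<le> b" "b \<le> \<tau>"
  defines "P \<equiv> \<tau> - a + 1 + b"
  shows "\<exists>E. {j. j mod P < b} \<inter> {i..i + \<tau>} \<subseteq> E \<and>
           (finite E \<and> card E \<le> a \<or> (\<exists>c l. l \<le> b \<and> E = {c..<c + l}))"
proof -
  have P: "P = \<tau> + 1 + b - a" "b \<le> P" "\<tau> + 1 \<le> P" "0 < P"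
    using assms by auto
  \<comment> \<open>\<open>c\<close> starts the period that contains \<open>i\<close>; only the
    bursts starting at \<open>c\<close> and at \<open>c + P\<close> can meet the window.\<close>
  define c where "c = P * (i div P)"
  have ci: "c \<le> i" "i < c + P"
    using mult_div_mod_eq[of P i] mod_less_divisor[OF P(4), of i] unfolding c_def by linarith+
  have fst_period: "j < c + b" if "j mod P < b" "i \<le> j" "j < c + P" for j
  proof -
    have "j mod P = j - c"
    proof -
      have "j - c < P" using that ci by linarith
      moreover have "j = (i div P) * P + (j - c)"
        using that(2) ci unfolding mult.commute[of _ P] c_def[symmetric] by linarith
      ultimately show ?thesis by (metis mod_less mod_mult_self3)
    qed
    then show ?thesis using that by linarith
  qed
  have snd_period: "j < c + P + b" if "j mod P < b" "c + P \<le> j" "j \<le> i + \<tau>" for j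
  proof -
    have "j - (c + P) < P" using that ci P by linarith
    moreover have "j = (i div P + 1) * P + (j - (c + P))"
      using that by (simp add: c_def algebra_simps)
    ultimately have "j mod P = j - (c + P)"
      by (metis mod_less mod_mult_self3)
    then show ?thesis using that by linarith
  qed
  consider "i + \<tau> < c + P" | "c + b \<le> i" | "c + P \<le> i + \<tau>" "i < c + b" by linarith
  then show ?thesis
  proof cases
    case 1
    then have "{j. j mod P < b} \<inter> {i..i + \<tau>} \<subseteq> {c..<c + b}"
      using fst_period ci by fastforce
    then show ?thesis by blast
  next
    case 2
    have "{j. j mod P < b} \<inter> {i..i + \<tau>} \<subseteq> {c + P..<c + P + b}"
    proof
      fix j assume j: "j \<in> {j. j mod P < b} \<inter> {i..i + \<tau>}"
      then have "c + P \<le> j" using fst_period[of j] 2 by force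
      then show "j \<in> {c + P..<c + P + b}" using snd_period[of j] j by auto
    qed
    then show ?thesis by blast
  next
    case 3
    let ?E = "{i..<c + b} \<union> {c + P..<i + \<tau> + 1}"
    have "{j. j mod P < b} \<inter> {i..i + \<tau>} \<subseteq> ?E"
    proof
      fix j assume j: "j \<in> {j. j mod P < b} \<inter> {i..i + \<tau>}"
      then show "j \<in> ?E" using fst_period[of j] by (cases "j < c + P") auto
    qed
    \<comment> \<open>The two lengths add up to \<open>b + \<tau> + 1 - P\<close>, which equals
      \<open>a\<close> by the choice of \<open>P\<close>.\<close>
    moreover have "card ?E \<le> (c + b - i) + (i + \<tau> + 1 - (c + P))"
      by (rule order.trans[OF card_Un_le]) simp
    then have "card ?E \<le> a" using 3 P assms(1,2) by linarith
    moreover have "finite ?E" by simp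
    ultimately show ?thesis by blast
  qed
qed

lemma card_periodic_gaps:
  fixes b G N :: nat
  shows "card ({..<N * (G + b)} - {j. j mod (G + b) < b}) \<le> N * G"
proof (induction N)
  case (Suc N)
  let ?P = "G + b"
  have "{..<Suc N * ?P} - {j. j mod ?P < b}
      \<subseteq> ({..<N * ?P} - {j. j mod ?P < b}) \<union> {N * ?P + b..<N * ?P + ?P}"
  proof
    fix j assume j: "j \<in> {..<Suc N * ?P} - {j. j mod ?P < b}"
    show "j \<in> ({..<N * ?P} - {j. j mod ?P < b}) \<union> {N * ?P + b..<N * ?P + ?P}"
    proof (cases "j < N * ?P")
      case False
      moreover have "j - N * ?P < ?P" using j False by (auto simp: algebra_simps)
      ultimately have "j mod ?P = j - N * ?P"
        by (metis add_diff_inverse_nat mod_less mod_mult_self3)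
      then show ?thesis using j False by (auto simp: algebra_simps)
    qed (use j in auto)
  qed
  then have "card ({..<Suc N * ?P} - {j. j mod ?P < b})
      \<le> card (({..<N * ?P} - {j. j mod ?P < b}) \<union> {N * ?P + b..<N * ?P + ?P})"
    by (intro card_mono) auto
  also have "\<dots> \<le> card ({..<N * ?P} - {j. j mod ?P < b}) + card {N * ?P + b..<N * ?P + ?P}"
    by (rule card_Un_le)
  also have "\<dots> \<le> N * G + G" using Suc.IH by simp
  finally show ?case by simp
qed simp

section \<open>Causal codes with decoding delay\<close>

text \<open>Strong induction on \<open>i\<close> recovers the messages one after another:
  \<open>step\<close> may take the earlier ones as known, and the deadlines of the first
  \<open>K\<close> messages lie before slot \<open>K + \<tau>\<close>. So the map from message
  sequences to unerased packets is injective.\<close>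

lemma causal_code_count:
  fixes X :: "(nat \<Rightarrow> 'm) \<Rightarrow> nat \<Rightarrow> 'p" and E :: "nat set"
  assumes fin: "finite M" "finite S" and "M \<noteq> {}"
    and range: "\<And>m j. (\<forall>l. m l \<in> M) \<Longrightarrow> X m j \<in> S"
    and step: "\<And>m m' i. \<lbrakk>\<forall>l. m l \<in> M; \<forall>l. m' l \<in> M; \<forall>l<i. m l = m' l;
        \<forall>j\<le>i + \<tau>. j \<notin> E \<longrightarrow> X m j = X m' j\<rbrakk> \<Longrightarrow> m i = m' i"
  shows "card M ^ K \<le> card S ^ card ({..<K + \<tau>} - E)"
proof -
  obtain v where v: "v \<in> M" using \<open>M \<noteq> {}\<close> by blast
  \<comment> \<open>Encoders act on infinite sequences, so the \<open>K\<close> free messages are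
    continued by the fixed message \<open>v\<close>, which leaves finitely many sequences to
    count.\<close>
  define ext where "ext f = (\<lambda>j. if j < K then f j else v)" for f :: "nat \<Rightarrow> 'm"
  define J where "J = {..<K + \<tau>} - E"
  define \<Phi> where "\<Phi> f = restrict (X (ext f)) J" for f
  have ext: "\<forall>l. ext f l \<in> M" if "f \<in> {..<K} \<rightarrow>\<^sub>E M" for f
    using that v by (auto simp: ext_def)
  have "inj_on \<Phi> ({..<K} \<rightarrow>\<^sub>E M)"
  proof (rule inj_onI)
    fix f f' assume f: "f \<in> {..<K} \<rightarrow>\<^sub>E M" and f': "f' \<in> {..<K} \<rightarrow>\<^sub>E M" and eq: "\<Phi> f = \<Phi> f'"
    have X: "X (ext f) j = X (ext f') j" if "j < K + \<tau>" "j \<notin> E" for j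
      using fun_cong[OF eq, of j] that by (simp add: \<Phi>_def J_def)
    have "i < K \<longrightarrow> ext f i = ext f' i" for i
    proof (induction i rule: less_induct)
      case (less i)
      then show ?case
        using step[OF ext[OF f] ext[OF f'], of i] X by auto
    qed
    then show "f = f'"
      by (intro PiE_ext[OF f f']) (simp add: ext_def)
  qed
  moreover have "\<Phi> ` ({..<K} \<rightarrow>\<^sub>E M) \<subseteq> J \<rightarrow>\<^sub>E S"
    using range ext by (auto simp: \<Phi>_def)
  moreover have "finite (J \<rightarrow>\<^sub>E S)"
    using fin by (intro finite_PiE) (auto simp: J_def)
  ultimately have "card ({..<K} \<rightarrow>\<^sub>E M) \<le> card (J \<rightarrow>\<^sub>E S)"
    by (rule card_inj_on_le)
  then show ?thesis
    by (simp add: card_funcsetE J_def)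
qed

text \<open>The abstract \<open>X\<close> lets both hops be instances. \<open>decode\<close> speaks
  only of a small finite set or a single burst, and each message is decoded with such a pattern of
  its own; the periodic set never has to be permissible as a whole.\<close>

lemma causal_code_rate:
  fixes X :: "(nat \<Rightarrow> 'm) \<Rightarrow> nat \<Rightarrow> 'p" and a b \<tau> q k n :: nat
  assumes ab: "a \<le> b" "b \<le> \<tau>" and q: "2 \<le> q"
    and M: "card M = q ^ k" and S: "card S = q ^ n"
    and range: "\<And>m j. (\<forall>l. m l \<in> M) \<Longrightarrow> X m j \<in> S"
    and causal: "\<And>m m' j. \<lbrakk>\<forall>l. m l \<in> M; \<forall>l. m' l \<in> M; \<forall>l\<le>j. m l = m' l\<rbrakk> \<Longrightarrow> X m j = X m' j"
    and decode: "\<And>E m m' i. \<lbrakk>finite E \<and> card E \<le> a \<or> (\<exists>c l. l \<le> b \<and> E = {c..<c + l});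
        \<forall>l. m l \<in> M; \<forall>l. m' l \<in> M; \<forall>j\<le>i + \<tau>. j \<notin> E \<longrightarrow> X m j = X m' j\<rbrakk> \<Longrightarrow> m i = m' i"
  shows "k * (\<tau> - a + 1 + b) \<le> n * (\<tau> - a + 1)"
proof -
  define G where "G = \<tau> - a + 1"
  define E where "E = {j. j mod (G + b) < b}"
  have pos: "card M > 0" "card S > 0" using M S q by simp_all
  then have fin: "finite M" "finite S" "M \<noteq> {}" by (auto intro: card_ge_0_finite)
  have step: "m i = m' i"
    if m: "\<forall>l. m l \<in> M" "\<forall>l. m' l \<in> M" and known: "\<forall>l<i. m l = m' l"
      and recv: "\<forall>j\<le>i + \<tau>. j \<notin> E \<longrightarrow> X m j = X m' j" for m m' i
  proof -
    obtain E' where E': "E \<inter> {i..i + \<tau>} \<subseteq> E'"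
      and good: "finite E' \<and> card E' \<le> a \<or> (\<exists>c l. l \<le> b \<and> E' = {c..<c + l})"
      using periodic_window[OF ab, of i] unfolding E_def G_def by blast
    \<comment> \<open>Before slot \<open>i\<close> the packets agree by causality, whether erased or
      not; from slot \<open>i\<close> on, a slot outside \<open>E'\<close> is also outside
      \<open>E\<close>.\<close>
    have "X m j = X m' j" if "j \<le> i + \<tau>" "j \<notin> E'" for j
    proof (cases "j < i")
      case True
      then show ?thesis using known by (intro causal m) auto
    next
      case False
      then show ?thesis using E' recv that by auto
    qed
    then show ?thesis using decode[OF good m] by blast
  qed
  \<comment> \<open>The final \<open>\<tau>\<close> slots are all counted as unerased, at a cost of
    \<open>n * \<tau>\<close> that does not depend on \<open>N\<close>.\<close>
  have count: "k * (N * (G + b)) \<le> n * (N * G + \<tau>)" for N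
  proof -
    have "{..<N * (G + b) + \<tau>} - E \<subseteq> ({..<N * (G + b)} - E) \<union> {N * (G + b)..<N * (G + b) + \<tau>}"
      by auto
    then have "card ({..<N * (G + b) + \<tau>} - E)
        \<le> card (({..<N * (G + b)} - E) \<union> {N * (G + b)..<N * (G + b) + \<tau>})"
      by (intro card_mono) auto
    also have "\<dots> \<le> card ({..<N * (G + b)} - E) + \<tau>"
      by (rule order.trans[OF card_Un_le]) simp
    also have "\<dots> \<le> N * G + \<tau>"
      using card_periodic_gaps[of N G b] by (simp add: E_def)
    finally have J: "card ({..<N * (G + b) + \<tau>} - E) \<le> N * G + \<tau>" .
    have "card M ^ (N * (G + b)) \<le> card S ^ card ({..<N * (G + b) + \<tau>} - E)"
      by (rule causal_code_count[where X = X, OF fin]) (use range step in blast)+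
    then have "q ^ (k * (N * (G + b))) \<le> q ^ (n * card ({..<N * (G + b) + \<tau>} - E))"
      by (simp add: M S power_mult)
    then have "k * (N * (G + b)) \<le> n * card ({..<N * (G + b) + \<tau>} - E)"
      using q by (simp add: power_le_imp_le_exp)
    also have "\<dots> \<le> n * (N * G + \<tau>)" using J by simp
    finally show ?thesis .
  qed
  show ?thesis
  proof (rule ccontr)
    assume "\<not> ?thesis"
    then have "n * G + 1 \<le> k * (G + b)" by (simp add: G_def)
    \<comment> \<open>Instead of a limit in \<open>N\<close>, take
      \<open>N = n * \<tau> + 1\<close>: an excess of at least 1 per period then outweighs the
      boundary cost \<open>n * \<tau>\<close>.\<close>
    then have "(n * \<tau> + 1) * (n * G + 1) \<le> (n * \<tau> + 1) * (k * (G + b))"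
      by (rule mult_le_mono2)
    also have "\<dots> \<le> n * ((n * \<tau> + 1) * G + \<tau>)"
      using count[of "n * \<tau> + 1"] by (simp add: algebra_simps)
    finally show False by (simp add: algebra_simps)
  qed
qed

lemma rate_le_p2p_capacity:
  fixes k n n' :: nat
  assumes "a \<le> \<tau>" "0 < k" and bound: "k * (\<tau> - a + 1 + b) \<le> n * (\<tau> - a + 1)" and "n \<le> n'"
  shows "real k / real n' \<le> p2p_capacity a b \<tau>"
proof -
  define G where "G = \<tau> - a + 1"
  have "real G = real \<tau> - real a + 1" using assms(1) by (simp add: G_def)
  then have cap: "p2p_capacity a b \<tau> = real G / real (G + b)"
    by (simp add: p2p_capacity_def)
  have G: "0 < G" by (simp add: G_def)
  have "k * (G + b) \<le> n' * G"
    using bound mult_le_mono1[OF \<open>n \<le> n'\<close>, of G] unfolding G_def by linarith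
  moreover have "0 < k * (G + b)" using \<open>0 < k\<close> G by simp
  ultimately have "0 < n'" by (metis gr0I leD mult_0)
  moreover have "real k * real (G + b) \<le> real n' * real G"
    using \<open>k * (G + b) \<le> n' * G\<close> by (metis of_nat_le_iff of_nat_mult)
  ultimately show ?thesis
    using G unfolding cap by (simp add: field_simps)
qed

section \<open>The two hops of a decode-and-forward code\<close>

lemma finite_field_card_ge_2:
  assumes "field F" "finite (carrier F)"
  shows "2 \<le> card (carrier F)"
proof -
  interpret field F by fact
  have "card {\<zero>\<^bsub>F\<^esub>, \<one>\<^bsub>F\<^esub>} \<le> card (carrier F)"
    using assms by (intro card_mono) auto
  then show ?thesis by simp
qed

lemma card_packets:
  assumes "finite (carrier F)"
  shows "card (packets F n) = card (carrier F) ^ n"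
  using card_lists_length_eq[OF assms, of n] by (simp add: packets_def)

lemma upto_time_cong:
  assumes "\<And>j. j \<le> i \<Longrightarrow> z j = z' j"
  shows "upto_time z i = upto_time z' i"
  using assms by (simp add: upto_time_def)

lemma received_cong:
  assumes "j \<notin> E \<Longrightarrow> x j = x' j"
  shows "received E x j = received E x' j"
  using assms by (simp add: received_def)

lemma upto_time_nth: "j \<le> i \<Longrightarrow> upto_time z i ! j = z j"
  by (simp add: upto_time_def del: upt_Suc)

text \<open>If two message sequences look alike to the relay up to slot \<open>i + (T - b2)\<close>,
  the relay sends the same packets up to there. A second-hop burst hides all later slots before the
  deadline, so the destination cannot tell the sequences apart.\<close>

lemma source_hop_rate:
  assumes F: "field F" "finite (carrier F)"
    and code: "streaming_code F a1 b1 T1 a2 b2 T2 T k n1 n2 par rel"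
    and "a1 \<le> b1" "b1 + b2 \<le> T"
  shows "k * (T - b2 - a1 + 1 + b1) \<le> n1 * (T - b2 - a1 + 1)"
proof (rule causal_code_rate[where X = "source_tx par"])
  show "card (packets F k) = card (carrier F) ^ k" "card (packets F n1) = card (carrier F) ^ n1"
    using F(2) by (rule card_packets)+
  show "source_tx par m j \<in> packets F n1" if "\<forall>l. m l \<in> packets F k" for m j
  proof -
    have "par j (upto_time m j) \<in> packets F (n1 - k)" "k \<le> n1"
      using code that unfolding streaming_code_def df_code_def by blast+
    moreover have "m j \<in> packets F k" using that ..
    ultimately show ?thesis by (auto simp: source_tx_def packets_def)
  qed
  show "source_tx par m j = source_tx par m' j" if "\<forall>l\<le>j. m l = m' l" for m m' j
    using that upto_time_cong[of j m m'] by (simp add: source_tx_def)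
  show "m i = m' i"
    if E: "finite E \<and> card E \<le> a1 \<or> (\<exists>c l. l \<le> b1 \<and> E = {c..<c + l})"
      and m: "\<forall>l. m l \<in> packets F k" "\<forall>l. m' l \<in> packets F k"
      and recv: "\<forall>j\<le>i + (T - b2). j \<notin> E \<longrightarrow> source_tx par m j = source_tx par m' j"
    for E m m' i
  proof -
    have E1: "permissible a1 b1 T1 E"
      using E permissible_card permissible_burst by blast
    define E2 where "E2 = {i + (T - b2) + 1..<i + (T - b2) + 1 + b2}"
    have E2: "permissible a2 b2 T2 E2"
      unfolding E2_def by (rule permissible_burst) simp
    have relay: "relay_tx par rel E m j = relay_tx par rel E m' j" if "j \<le> i + (T - b2)" for j
    proof -
      have "upto_time (received E (source_tx par m)) j = upto_time (received E (source_tx par m')) j"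
        using recv that by (intro upto_time_cong received_cong) auto
      then show ?thesis by (simp add: relay_tx_def)
    qed
    have "upto_time (received E2 (relay_tx par rel E m)) (i + T)
        = upto_time (received E2 (relay_tx par rel E m')) (i + T)"
      using assms(5) by (intro upto_time_cong received_cong relay) (auto simp: E2_def)
    then show ?thesis
      using code E1 E2 m unfolding streaming_code_def by metis
  qed
qed (use assms finite_field_card_ge_2[OF F] in auto)

text \<open>Under a burst on the last \<open>b1\<close> slots up to and including \<open>j\<close>,
  the relay sees only source packets of slots up to \<open>j - b1\<close>. Independence of the
  erasure pattern carries the conclusion over to the pattern without erasures.\<close>

lemma relay_tx_delayed:
  assumes code: "df_code F a1 b1 T1 k n1 n2 par rel"
    and m: "\<forall>l. m l \<in> packets F k" "\<forall>l. m' l \<in> packets F k"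
    and eq: "\<And>l. l + b1 \<le> j \<Longrightarrow> m l = m' l"
  shows "relay_tx par rel {} m j = relay_tx par rel {} m' j"
proof -
  \<comment> \<open>If \<open>j + 1 < b1\<close>, truncated subtraction starts the burst at slot 0,
    and it still covers every slot up to \<open>j\<close>.\<close>
  define E where "E = {j + 1 - b1..<j + 1 - b1 + b1}"
  have E: "permissible a1 b1 T1 E" "permissible a1 b1 T1 {}"
    using permissible_burst[of 0 b1 a1 T1 0] unfolding E_def by (auto intro: permissible_burst)
  have src: "source_tx par m l = source_tx par m' l" if "l + b1 \<le> j" for l
    using that upto_time_cong[of l m m'] eq by (simp add: source_tx_def)
  have "relay_tx par rel E m j = relay_tx par rel E m' j"
  proof -
    have "upto_time (received E (source_tx par m)) j = upto_time (received E (source_tx par m')) j"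
      by (intro upto_time_cong received_cong src) (auto simp: E_def)
    then show ?thesis by (simp add: relay_tx_def)
  qed
  moreover have "relay_tx par rel E z j = relay_tx par rel {} z j" if "\<forall>l. z l \<in> packets F k" for z
    using code E that unfolding df_code_def by metis
  ultimately show ?thesis using m by simp
qed

text \<open>By \<open>relay_tx_delayed\<close> the relay's packet of slot \<open>j + b1\<close> is a
  causal function of the messages up to \<open>j\<close>. In this shifted time the deadline
  \<open>i + T\<close> becomes \<open>i + (T - b1)\<close>.\<close>

lemma relay_hop_rate:
  assumes F: "field F" "finite (carrier F)"
    and code: "streaming_code F a1 b1 T1 a2 b2 T2 T k n1 n2 par rel"
    and "a2 \<le> b2" "b1 + b2 \<le> T"
  shows "k * (T - b1 - a2 + 1 + b2) \<le> n2 * (T - b1 - a2 + 1)"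
proof (rule causal_code_rate[where X = "\<lambda>m j. relay_tx par rel {} m (j + b1)"])
  have df: "df_code F a1 b1 T1 k n1 n2 par rel"
    using code by (simp add: streaming_code_def)
  have E1: "permissible a1 b1 T1 {}"
    by (rule permissible_card) auto
  show "card (packets F k) = card (carrier F) ^ k" "card (packets F n2) = card (carrier F) ^ n2"
    using F(2) by (rule card_packets)+
  show "relay_tx par rel {} m (j + b1) \<in> packets F n2" if "\<forall>l. m l \<in> packets F k" for m j
    using df E1 that unfolding df_code_def by blast
  show "relay_tx par rel {} m (j + b1) = relay_tx par rel {} m' (j + b1)"
    if "\<forall>l. m l \<in> packets F k" "\<forall>l. m' l \<in> packets F k" "\<forall>l\<le>j. m l = m' l" for m m' j
    using that by (intro relay_tx_delayed[OF df]) auto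
  show "m i = m' i"
    if E: "finite E \<and> card E \<le> a2 \<or> (\<exists>c l. l \<le> b2 \<and> E = {c..<c + l})"
      and m: "\<forall>l. m l \<in> packets F k" "\<forall>l. m' l \<in> packets F k"
      and recv: "\<forall>j\<le>i + (T - b1). j \<notin> E \<longrightarrow>
        relay_tx par rel {} m (j + b1) = relay_tx par rel {} m' (j + b1)"
    for E m m' i
  proof -
    define E2 where "E2 = (\<lambda>j. j + b1) ` E"
    have E2: "permissible a2 b2 T2 E2"
      using E
    proof
      assume "finite E \<and> card E \<le> a2"
      then show ?thesis
        unfolding E2_def by (intro permissible_card) (auto intro: card_image_le[THEN order.trans])
    next
      assume "\<exists>c l. l \<le> b2 \<and> E = {c..<c + l}"
      then obtain c l where l: "l \<le> b2" and "E = {c..<c + l}" by blast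
      then have "E2 = {c + b1..<c + b1 + l}"
        unfolding E2_def by (simp add: add_ac)
      with l show ?thesis by (simp add: permissible_burst)
    qed
    have "relay_tx par rel {} m j = relay_tx par rel {} m' j" if "j \<le> i + T" "j \<notin> E2" for j
    \<comment> \<open>Slots before \<open>b1\<close> have no counterpart in shifted time, but their
      packets do not depend on the messages at all: the agreement required by
      \<open>relay_tx_delayed\<close> is vacuous there.\<close>
    proof (cases "j < b1")
      case True
      then show ?thesis using m by (intro relay_tx_delayed[OF df]) auto
    next
      case False
      then have j: "j = (j - b1) + b1" by simp
      then have "j - b1 \<notin> E" using that(2) unfolding E2_def by blast
      moreover have "j - b1 \<le> i + (T - b1)" using that(1) False assms(5) by linarith
      ultimately show ?thesis using recv j by metis
    qed
    then have "upto_time (received E2 (relay_tx par rel {} m)) (i + T)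
        = upto_time (received E2 (relay_tx par rel {} m')) (i + T)"
      by (intro upto_time_cong received_cong) auto
    then show ?thesis
      using code E1 E2 m unfolding streaming_code_def by metis
  qed
qed (use assms finite_field_card_ge_2[OF F] in auto)

section \<open>The repetition code\<close>

definition Z2 :: "nat ring" where
  "Z2 = \<lparr>carrier = {0, 1}, mult = (*), one = 1, zero = 0, add = (\<lambda>x y. (x + y) mod 2)\<rparr>"

lemma field_Z2: "field Z2"
proof -
  have "cring Z2"
  proof (rule cringI)
    show "abelian_group Z2"
      by (rule abelian_groupI) (auto simp: Z2_def)
    show "comm_monoid Z2"
      by (rule comm_monoidI) (auto simp: Z2_def)
  qed (auto simp: Z2_def)
  then interpret cring Z2 .
  show ?thesis
    by (rule cring_fieldI) (auto simp: Z2_def Units_def)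
qed

text \<open>The symbol \<open>z s\<close> stands at position \<open>e\<close> of the packet of slot
  \<open>s + e\<close>, for every \<open>e \<le> b\<close>; hence any single one of these
  \<open>b + 1\<close> packets reveals it.\<close>

definition repeated :: "(nat \<Rightarrow> nat) \<Rightarrow> nat \<Rightarrow> nat \<Rightarrow> nat list" where
  "repeated z b i = map (\<lambda>d. if d \<le> i then z (i - d) else 0) [0..<Suc b]"

definition lookup_repeated :: "nat \<Rightarrow> nat list option list \<Rightarrow> nat \<Rightarrow> nat" where
  "lookup_repeated b ys s = (let e = (SOME e. e \<le> b \<and> ys ! (s + e) \<noteq> None) in the (ys ! (s + e)) ! e)"

lemma lookup_repeated_eq:
  assumes E: "permissible a b \<tau> E" "a \<le> b" "b \<le> \<tau>"
    and x: "\<And>j. j \<le> i \<Longrightarrow> x j = repeated z b j" and "s + b \<le> i"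
  shows "lookup_repeated b (upto_time (received E x) i) s = z s"
proof -
  let ?ys = "upto_time (received E x) i"
  have ys: "?ys ! (s + e) = (if s + e \<in> E then None else Some (repeated z b (s + e)))"
    if "e \<le> b" for e
    using that assms(5) x by (simp add: upto_time_nth received_def)
  define e where "e = (SOME e. e \<le> b \<and> ?ys ! (s + e) \<noteq> None)"
  have "\<exists>e. e \<le> b \<and> ?ys ! (s + e) \<noteq> None"
    using permissible_unerased[OF E, of s] ys by force
  then have e: "e \<le> b" "?ys ! (s + e) \<noteq> None"
    unfolding e_def by (rule someI2_ex; blast)+
  then have "?ys ! (s + e) = Some (repeated z b (s + e))"
    using ys[of e] by (simp split: if_splits)
  moreover have "repeated z b (s + e) ! e = z s"
    using e(1) by (simp add: repeated_def del: upt_Suc)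
  ultimately show ?thesis
    unfolding lookup_repeated_def Let_def e_def[symmetric] by simp
qed

lemma repeated_cong:
  assumes "\<And>j. j \<le> i \<Longrightarrow> z j = z' j"
  shows "repeated z b i = repeated z' b i"
  using assms by (simp add: repeated_def)

lemma repeated_in_packets:
  assumes "\<And>j. z j \<in> carrier Z2"
  shows "repeated z b i \<in> packets Z2 (Suc b)"
  using assms by (auto simp: repeated_def packets_def simp del: upt_Suc) (simp add: Z2_def)

text \<open>The relay knows a symbol for certain \<open>b1\<close> slots after it was first sent,
  and only then starts to repeat it, so its packets do not depend on the erasures. The destination
  has the symbol after \<open>b1 + b2 \<le> T\<close> slots.\<close>

lemma repetition_code:
  assumes "a1 \<le> b1" "b1 \<le> T1" "a2 \<le> b2" "b2 \<le> T2" "b1 + b2 \<le> T"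
  shows "\<exists>par rel. streaming_code Z2 a1 b1 T1 a2 b2 T2 T 1 (Suc b1) (Suc b2) par rel"
proof -
  define par where "par i ms = map (\<lambda>d. if d \<le> i then hd (ms ! (i - d)) else 0) [1..<Suc b1]"
    for i and ms :: "nat list list"
  define rel where
    "rel i ys = repeated (\<lambda>j. if b1 \<le> j then lookup_repeated b1 ys (j - b1) else 0) b2 i"
    for i ys
  define shifted where "shifted m = (\<lambda>j. if b1 \<le> j then hd (m (j - b1)) else 0)"
    for m :: "nat \<Rightarrow> nat list"
  have hd_m: "m j = [hd (m j)]" "hd (m j) \<in> carrier Z2" if "\<forall>j. m j \<in> packets Z2 1" for m j
    using that[rule_format, of j] by (auto simp: packets_def length_Suc_conv)
  have par: "par i (upto_time m i) = map (\<lambda>d. if d \<le> i then hd (m (i - d)) else 0) [1..<Suc b1]"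
    for m i
    unfolding par_def by (intro map_cong) (auto simp: upto_time_nth)
  have source: "source_tx par m i = repeated (\<lambda>j. hd (m j)) b1 i"
    if "\<forall>j. m j \<in> packets Z2 1" for m i
  proof -
    \<comment> \<open>Position 0 of the repeated packet is the message symbol itself and the other
      positions are the parity, so the code is systematic as required.\<close>
    have "[0..<Suc b1] = 0 # [1..<Suc b1]" by (simp add: upt_conv_Cons del: upt_Suc)
    then show ?thesis
      using hd_m(1)[OF that, of i] by (simp add: source_tx_def par repeated_def del: upt_Suc)
  qed
  have relay: "relay_tx par rel E m i = repeated (shifted m) b2 i"
    if E: "permissible a1 b1 T1 E" and m: "\<forall>j. m j \<in> packets Z2 1" for E m i
    unfolding relay_tx_def rel_def
  proof (rule repeated_cong)
    fix j assume "j \<le> i"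
    then show "(if b1 \<le> j
        then lookup_repeated b1 (upto_time (received E (source_tx par m)) i) (j - b1) else 0)
        = shifted m j"
      using lookup_repeated_eq[OF E assms(1,2), of i "source_tx par m" "\<lambda>j. hd (m j)" "j - b1"]
        source[OF m] by (simp add: shifted_def)
  qed
  have "df_code Z2 a1 b1 T1 1 (Suc b1) (Suc b2) par rel"
    unfolding df_code_def
  proof (intro conjI allI impI exI[of _ "\<lambda>i ms. repeated (shifted ((!) ms)) b2 i"])
    fix m :: "nat \<Rightarrow> nat list" and i assume "\<forall>j. m j \<in> packets Z2 1"
    moreover have "0 \<in> carrier Z2" by (simp add: Z2_def)
    ultimately show "par i (upto_time m i) \<in> packets Z2 (Suc b1 - 1)"
      using hd_m(2) by (auto simp: par packets_def simp del: upt_Suc)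
  next
    fix E i and m :: "nat \<Rightarrow> nat list" assume "permissible a1 b1 T1 E" and m: "\<forall>j. m j \<in> packets Z2 1"
    then show "relay_tx par rel E m i \<in> packets Z2 (Suc b2)"
      using hd_m(2)[OF m]
      by (simp add: relay, intro repeated_in_packets) (auto simp: shifted_def Z2_def)
  next
    fix E i and m :: "nat \<Rightarrow> nat list" assume "permissible a1 b1 T1 E" and m: "\<forall>j. m j \<in> packets Z2 1"
    moreover have "repeated (shifted m) b2 i = repeated (shifted ((!) (upto_time m i))) b2 i"
      by (rule repeated_cong) (auto simp: shifted_def upto_time_nth)
    ultimately show "relay_tx par rel E m i = repeated (shifted ((!) (upto_time m i))) b2 i"
      by (simp add: relay)
  qed auto
  moreover have "[lookup_repeated b2 (upto_time (received E2 (relay_tx par rel E1 m)) (i + T)) (i + b1)]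
      = m i"
    if "permissible a1 b1 T1 E1" "permissible a2 b2 T2 E2" and m: "\<forall>j. m j \<in> packets Z2 1"
    for E1 E2 m i
    using lookup_repeated_eq[OF that(2) assms(3,4), of "i + T" "relay_tx par rel E1 m" "shifted m" "i + b1"]
      relay[OF that(1) m] assms(5) hd_m(1)[OF m, of i]
    by (simp add: shifted_def)
  ultimately have "streaming_code Z2 a1 b1 T1 a2 b2 T2 T 1 (Suc b1) (Suc b2) par rel"
    unfolding streaming_code_def
    \<comment> \<open>The relay's stream is delayed by \<open>b1\<close>, so the symbol of
      \<open>m i\<close> has index \<open>i + b1\<close> in it.\<close>
    by (intro conjI exI[of _ "\<lambda>i ys. [lookup_repeated b2 ys (i + b1)]"]) blast+
  then show ?thesis by blast
qed

theorem theorem1: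
  fixes a1 b1 T1 a2 b2 T2 T :: nat
  assumes "0 < a1" and "a1 \<le> b1" and "b1 \<le> T1" and "T1 < T"
    and "0 < a2" and "a2 \<le> b2" and "b2 \<le> T2" and "T2 < T"
    and "b1 + b2 \<le> T"
  shows "df_capacity a1 b1 T1 a2 b2 T2 T
           \<le> min (p2p_capacity a1 b1 (T - b2)) (p2p_capacity a2 b2 (T - b1))"
  unfolding df_capacity_def
proof (rule cSup_least)
  \<comment> \<open>\<open>cSup_least\<close> needs a nonempty set; the real \<open>Sup\<close> of
    the empty set would carry no information.\<close>
  obtain par rel where "streaming_code Z2 a1 b1 T1 a2 b2 T2 T 1 (Suc b1) (Suc b2) par rel"
    using repetition_code[of a1 b1 T1 a2 b2 T2 T] assms by blast
  moreover have "finite (carrier Z2)" by (simp add: Z2_def)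
  ultimately show "achievable_rates a1 b1 T1 a2 b2 T2 T \<noteq> {}"
    using field_Z2 unfolding achievable_rates_def by blast
next
  fix R assume "R \<in> achievable_rates a1 b1 T1 a2 b2 T2 T"
  then obtain k n1 n2 par rel and F :: "nat ring" where R: "R = real k / real (max n1 n2)"
    and F: "field F" "finite (carrier F)"
    and code: "streaming_code F a1 b1 T1 a2 b2 T2 T k n1 n2 par rel"
    unfolding achievable_rates_def by blast
  have k: "0 < k" using code by (auto simp: streaming_code_def df_code_def)
  have "R \<le> p2p_capacity a1 b1 (T - b2)"
    unfolding R using assms k
    by (intro rate_le_p2p_capacity[OF _ _ source_hop_rate[OF F code]]) auto
  moreover have "R \<le> p2p_capacity a2 b2 (T - b1)"
    unfolding R using assms k
    by (intro rate_le_p2p_capacity[OF _ _ relay_hop_rate[OF F code]]) auto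
  ultimately show "R \<le> min (p2p_capacity a1 b1 (T - b2)) (p2p_capacity a2 b2 (T - b1))"
    by simp
qed

end
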